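(* The quartic equation $$\begin{aligned} &6x_1^4+(30x_2^2+10x_2x_3-6x_2x_4-9x_3^2-3x_3x_4-9x_4^2)x_1^2\\ &+54x_2^4+36x_2^3x_3+18x_2^3x_4-105x_2^2x_3^2-105x_2^2x_3x_4\\ &-261x_2^2x_4^2+12x_2x_3^3+18x_2x_3^2x_4+42x_2x_3x_4^2+18x_2x_4^3\\ &+3x_3^4+6x_3^3x_4+9x_3^2x_4^2+6x_3x_4^3-9x_4^4=0 \end{aligned}$$ has infinitely many integer solutions $(x_1,x_2,x_3,x_4)$.
   Context: Solutions differing by a nonzero rational scalar factor are considered equivalent and are counted as one solution; solutions considered satisfy $(x_1,x_2)\neq(0,0)$ and $(x_3,x_4)\neq(0,0)$. Thus the claim is that there are infinitely many pairwise non-proportional such integer solutions. *)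

theory Defs
  imports Complex_Main
begin

definition quartic_form :: "int \<Rightarrow> int \<Rightarrow> int \<Rightarrow> int \<Rightarrow> int" where
  "quartic_form x1 x2 x3 x4 =
     6*x1^4 + (30*x2^2 + 10*x2*x3 - 6*x2*x4 - 9*x3^2 - 3*x3*x4 - 9*x4^2)*x1^2
     + 54*x2^4 + 36*x2^3*x3 + 18*x2^3*x4 - 105*x2^2*x3^2 - 105*x2^2*x3*x4
     - 261*x2^2*x4^2 + 12*x2*x3^3 + 18*x2*x3^2*x4 + 42*x2*x3*x4^2 + 18*x2*x4^3
     + 3*x3^4 + 6*x3^3*x4 + 9*x3^2*x4^2 + 6*x3*x4^3 - 9*x4^4"

definition quartic_solutions :: "(int \<times> int \<times> int \<times> int) set" where
  "quartic_solutions =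
     {(x1, x2, x3, x4). quartic_form x1 x2 x3 x4 = 0 \<and>
        (x1, x2) \<noteq> (0, 0) \<and> (x3, x4) \<noteq> (0, 0)}"

definition proportional :: "int \<times> int \<times> int \<times> int \<Rightarrow> int \<times> int \<times> int \<times> int \<Rightarrow> bool" where
  "proportional = (\<lambda>(x1, x2, x3, x4) (y1, y2, y3, y4).
     \<exists>q::rat. q \<noteq> 0 \<and>
       of_int y1 = q * of_int x1 \<and> of_int y2 = q * of_int x2 \<and>
       of_int y3 = q * of_int x3 \<and> of_int y4 = q * of_int x4)"

definition proportional_rel ::
    "((int \<times> int \<times> int \<times> int) \<times> (int \<times> int \<times> int \<times> int)) set" where
  "proportional_rel =
     {(x, y). x \<in> quartic_solutions \<and> y \<in> quartic_solutions \<and> proportional x y}"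

lemma proportional_refl: "proportional x x"
  by (cases x) (auto simp: proportional_def intro!: exI[of _ 1])

lemma proportional_sym:
  assumes "proportional x y"
  shows "proportional y x"
proof -
  obtain x1 x2 x3 x4 y1 y2 y3 y4 where xy: "x = (x1, x2, x3, x4)" "y = (y1, y2, y3, y4)"
    by (cases x, cases y) auto
  with assms obtain q :: rat where "q \<noteq> 0"
    "of_int y1 = q * of_int x1" "of_int y2 = q * of_int x2"
    "of_int y3 = q * of_int x3" "of_int y4 = q * of_int x4"
    by (auto simp: proportional_def)
  then show ?thesis
    by (auto simp: xy proportional_def intro!: exI[of _ "inverse q"])
qed

lemma proportional_trans:
  assumes "proportional x y" "proportional y z"
  shows "proportional x z"
proof -
  obtain x1 x2 x3 x4 y1 y2 y3 y4 z1 z2 z3 z4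
    where xyz: "x = (x1, x2, x3, x4)" "y = (y1, y2, y3, y4)" "z = (z1, z2, z3, z4)"
    by (cases x, cases y, cases z) auto
  with assms obtain q r :: rat where "q \<noteq> 0" "r \<noteq> 0"
    "of_int y1 = q * of_int x1" "of_int y2 = q * of_int x2"
    "of_int y3 = q * of_int x3" "of_int y4 = q * of_int x4"
    "of_int z1 = r * of_int y1" "of_int z2 = r * of_int y2"
    "of_int z3 = r * of_int y3" "of_int z4 = r * of_int y4"
    by (auto simp: proportional_def)
  then show ?thesis
    by (auto simp: xyz proportional_def intro!: exI[of _ "r * q"])
qed

lemma equiv_proportional_rel: "equiv quartic_solutions proportional_rel"
  by (intro equivI refl_onI symI transI)
     (auto simp: proportional_rel_def intro: proportional_refl proportional_sym
        proportional_trans)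

end

theory Submission
  imports Defs "HOL-Number_Theory.Cong"
begin

text \<open>
  Write \<open>(a, b, c, d)\<close> for the coordinates and let \<open>w\<close> be a root of \<open>w^2 + w + 3\<close>, so that \<open>K = \<rat>(w)\<close>
  is the field \<open>\<rat>(\<surd>-11)\<close>. The quartic surface contains the line \<open>\<xi> = \<eta> = 0\<close>, where \<open>\<xi> = a + (1 + w) b\<close>
  and \<open>\<eta> = c - w d\<close>, and hence also its conjugate; these two lines are skew. Through a rational point of
  the surface passes exactly one line meeting both, and its points are obtained by multiplying
  \<open>(\<xi>, \<eta>)\<close> by scalars of \<open>K\<close>. That line meets the surface in one point of either line, in the given
  point, and in a fourth point, which is again rational. Passing to the fourth point is an involution
  of the surface, and so is \<open>a \<mapsto> -a\<close>. Their composition is an automorphism of infinite order, and the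
  orbit of \<open>(0, 1, 1, 0)\<close> under it is infinite. In coordinates the automorphism is given by quintic
  forms, which is what \<open>quartic_form_involution\<close> verifies.

  That the orbit never closes up is a 7-adic fact. Modulo 7 the starting point is fixed and the
  automorphism acts near it by a unipotent map, so the orbit can be interpolated 7-adically: in
  Newton's expansion \<open>u n = (\<Sum>j. (n choose j) * \<Delta>^j u 0)\<close> of a coordinate \<open>u\<close> the differences \<open>\<Delta>^j u\<close> become
  more and more divisible by 7, so fast that the term \<open>n * \<Delta>u 0\<close> determines the exact power of 7
  dividing \<open>u n - u 0\<close> (\<open>nonzero_of_differences\<close>). The decay of the differences is proved with a
  multiplicative filtration on sequences that is raised by \<open>\<Delta>\<close> (\<open>filt_fdiff\<close>); to check this on the four
  coordinates, only the linear part of the map at \<open>(0, 1, 1, 0)\<close> has to be known (\<open>jet_fdiff\<close>). Applied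
  to the cross products of the first two coordinates this shows that no two points of the orbit are
  proportional.
\<close>

section \<open>Newton expansions and a 7-adic non-vanishing criterion\<close>

definition fdiff :: "(nat \<Rightarrow> int) \<Rightarrow> nat \<Rightarrow> int" where
  "fdiff u n = u (Suc n) - u n"

lemma newton_expansion:
  "u n = (\<Sum>j\<le>n. int (n choose j) * (fdiff ^^ j) u 0)"
proof (induction n arbitrary: u)
  case 0
  show ?case by simp
next
  case (Suc n)
  have "u (Suc n) = u n + fdiff u n"
    by (simp add: fdiff_def)
  also have "u n = (\<Sum>j\<le>Suc n. int (n choose j) * (fdiff ^^ j) u 0)"
    using Suc.IH[of u] by simp
  also have "\<dots> = u 0 + (\<Sum>j\<le>n. int (n choose Suc j) * (fdiff ^^ Suc j) u 0)"
    by (simp only: sum.atMost_Suc_shift) simp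
  also have "fdiff u n = (\<Sum>j\<le>n. int (n choose j) * (fdiff ^^ Suc j) u 0)"
    using Suc.IH[of "fdiff u"] by (simp add: funpow_swap1)
  finally have "u (Suc n) = u 0 + (\<Sum>j\<le>n. int (Suc n choose Suc j) * (fdiff ^^ Suc j) u 0)"
    by (simp add: sum.distrib[symmetric] algebra_simps)
  then show ?case
    by (simp only: sum.atMost_Suc_shift) simp
qed

lemma funpow_fdiff_shift:
  "(fdiff ^^ j) (\<lambda>n. u (m + n)) n = (fdiff ^^ j) u (m + n)"
  by (induction j arbitrary: n) (simp_all add: fdiff_def)

lemma seven_power_ge:
  assumes "w \<ge> 1"
  shows "5 * w + 2 \<le> (7::nat) ^ w"
  using assms by (induction w rule: dec_induct) simp_all

text \<open>
  From \<open>j * (n choose j) = n * ((n - 1) choose (j - 1))\<close>, the binomial coefficient loses at most the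
  power of 7 contained in \<open>j\<close> against that of \<open>n\<close>. The exponent \<open>\<lceil>(j + 4) / 5\<rceil>\<close>, written \<open>(j + 8) div 5\<close>, makes
  up for this loss with a surplus of two; at \<open>j = 7\<close> this is sharp.
\<close>

lemma binomial_term_dvd:
  fixes x :: int
  assumes j: "2 \<le> j" "j \<le> n" and x: "7 ^ ((j + 8) div 5) dvd x"
  shows "7 ^ (multiplicity 7 n + 2) dvd int (n choose j) * x"
proof -
  let ?v = "multiplicity 7 n" and ?w = "multiplicity 7 j"
  let ?c = "multiplicity 7 (n choose j)"
  have p: "prime_elem (7::nat)"
    by simp
  have pos: "n choose j \<noteq> 0" "(n - 1) choose (j - 1) \<noteq> 0"
    using j by simp_all
  have "j * (n choose j) = n * ((n - 1) choose (j - 1))"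
    using j by (simp add: times_binomial_minus1_eq)
  then have "multiplicity 7 (j * (n choose j)) = multiplicity 7 (n * ((n - 1) choose (j - 1)))"
    by simp
  then have le: "?v \<le> ?w + ?c"
    using p pos j by (simp add: prime_elem_multiplicity_mult_distrib)
  have "7 ^ ?w dvd j"
    by (rule multiplicity_dvd)
  then have "7 ^ ?w \<le> j"
    using j by (intro dvd_imp_le) auto
  then have "5 * ?w + 2 \<le> j"
    using j seven_power_ge[of ?w] by (cases "?w = 0") auto
  then have "?w + 2 \<le> (j + 8) div 5"
    by linarith
  then have "(7::int) ^ (?w + 2) dvd x"
    using x by (meson dvd_trans le_imp_power_dvd)
  moreover have "(7::int) ^ ?c dvd int (n choose j)"
    using multiplicity_dvd[of 7 "n choose j"] by (metis of_nat_dvd_iff of_nat_numeral of_nat_power)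
  ultimately have "(7::int) ^ (?c + (?w + 2)) dvd int (n choose j) * x"
    by (simp only: power_add mult_dvd_mono)
  moreover have "(7::int) ^ (?v + 2) dvd 7 ^ (?c + (?w + 2))"
    using le by (intro le_imp_power_dvd) simp
  ultimately show ?thesis
    by (rule dvd_trans[rotated])
qed

text \<open>
  In Newton's expansion the terms from \<open>j = 2\<close> on are divisible by 49 times the power of 7 in \<open>n\<close>,
  whereas \<open>n * fdiff u 0\<close> is not.
\<close>

lemma nonzero_of_differences:
  fixes u :: "nat \<Rightarrow> int"
  assumes u0: "u 0 = 0" and first: "\<not> 49 dvd fdiff u 0"
    and higher: "\<And>j. 2 \<le> j \<Longrightarrow> 7 ^ ((j + 8) div 5) dvd (fdiff ^^ j) u 0"
    and n: "0 < n"
  shows "u n \<noteq> 0"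
proof
  assume un: "u n = 0"
  let ?v = "multiplicity 7 n"
  let ?t = "\<lambda>j. int (n choose j) * (fdiff ^^ j) u 0"
  have split: "{..n} = insert 0 (insert 1 {2..n})"
    using n by auto
  have "u n = int n * fdiff u 0 + (\<Sum>j\<in>{2..n}. ?t j)"
    unfolding newton_expansion[of u n] split using u0 by simp
  then have "int n * fdiff u 0 = - (\<Sum>j\<in>{2..n}. ?t j)"
    using un by linarith
  moreover have "7 ^ (?v + 2) dvd (\<Sum>j\<in>{2..n}. ?t j)"
    by (intro dvd_sum binomial_term_dvd higher) auto
  ultimately have "7 ^ (?v + 2) dvd int n * fdiff u 0"
    by (simp only: dvd_minus_iff)
  moreover obtain k where k: "n = 7 ^ ?v * k" "\<not> 7 dvd k"
    using n multiplicity_decompose'[of n 7] by auto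
  have "int n = 7 ^ ?v * int k"
    using k(1) by (metis of_nat_mult of_nat_numeral of_nat_power)
  ultimately have "7 ^ ?v * 49 dvd 7 ^ ?v * (int k * fdiff u 0)"
    by (simp add: power_add mult.assoc)
  then have "49 dvd int k * fdiff u 0"
    by simp
  moreover have "coprime (49::int) (int k)"
  proof -
    have "coprime (7::nat) k"
      using k(2) by (intro prime_imp_coprime) auto
    then have "coprime (int 7 ^ 2) (int k)"
      by (simp only: coprime_int_iff coprime_power_left_iff) simp
    then show ?thesis
      by simp
  qed
  ultimately show False
    using first by (simp add: coprime_dvd_mult_right_iff)
qed

section \<open>A multiplicative filtration on integer sequences\<close>

text \<open>
  The weights are to be read as lower bounds for valuations with respect to a fictitious fifth root of 7:
  weight \<open>k\<close> stands for divisibility of the values by \<open>7^\<lceil>k/5\<rceil>\<close> (\<open>filt_dvd\<close>). Fractional valuations are needed because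
  the map below is unipotent modulo 7 but not trivial: passing to differences cannot gain a full factor
  7 at each stage. A gain of one fifth is available, and it outweighs the factors 7 that are lost to the
  indices \<open>j\<close> in the binomial coefficients. The set \<open>G\<close> lists the generators with their weights.
\<close>

inductive filt :: "(nat \<times> (nat \<Rightarrow> int)) set \<Rightarrow> nat \<Rightarrow> (nat \<Rightarrow> int) \<Rightarrow> bool"
  for G where
  gen: "(k, u) \<in> G \<Longrightarrow> filt G k u"
| const: "filt G 0 (\<lambda>_. m)"
| seven: "filt G 5 (\<lambda>_. 7)"
| add: "filt G k u \<Longrightarrow> filt G k v \<Longrightarrow> filt G k (\<lambda>n. u n + v n)"
| mult: "filt G j u \<Longrightarrow> filt G k v \<Longrightarrow> filt G (j + k) (\<lambda>n. u n * v n)"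
| weaken: "filt G j u \<Longrightarrow> k \<le> j \<Longrightarrow> filt G k u"

lemma filt_smult: "filt G k u \<Longrightarrow> filt G k (\<lambda>n. m * u n)"
  using filt.mult[OF filt.const] by fastforce

lemma filt_smult_seven:
  assumes "7 dvd m" "filt G k u"
  shows "filt G (k + 5) (\<lambda>n. m * u n)"
proof -
  obtain r where r: "m = r * 7"
    using assms(1) by (metis dvd_def mult.commute)
  show ?thesis
    using filt_smult[OF filt.mult[OF assms(2) filt.seven], of r] by (simp add: r ac_simps)
qed

lemma filt_const_seven: "7 dvd m \<Longrightarrow> filt G 5 (\<lambda>_. m)"
  using filt_smult_seven[OF _ filt.const, of m G 1] by simp

lemma filt_zero: "filt G k (\<lambda>_. 0)"
proof -
  have "filt G (5 * k) (\<lambda>_. 0)"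
  proof (induction k)
    case (Suc k)
    then show ?case
      using filt_smult_seven[of 0 G "5 * k"] by (simp add: algebra_simps)
  qed (simp add: filt.const)
  then show ?thesis
    by (rule filt.weaken) simp
qed

lemma filt_dvd:
  assumes "filt G k u" and gens: "\<And>k u. (k, u) \<in> G \<Longrightarrow> 7 ^ ((k + 4) div 5) dvd u n"
  shows "7 ^ ((k + 4) div 5) dvd u n"
  using assms(1)
proof (induction rule: filt.induct)
  case (mult j u k v)
  have "(7::int) ^ ((j + 4) div 5 + (k + 4) div 5) dvd u n * v n"
    using mult.IH by (simp only: power_add mult_dvd_mono)
  moreover have "(7::int) ^ ((j + k + 4) div 5) dvd 7 ^ ((j + 4) div 5 + (k + 4) div 5)"
    by (intro le_imp_power_dvd) linarith
  ultimately show ?case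
    by (rule dvd_trans[rotated])
next
  case (weaken j u k)
  have "(7::int) ^ ((k + 4) div 5) dvd 7 ^ ((j + 4) div 5)"
    using weaken.hyps by (intro le_imp_power_dvd div_le_mono) simp
  then show ?case
    using weaken.IH by (rule dvd_trans)
qed (use gens in auto)

text \<open>
  Taking differences is a twisted derivation,
  \<open>\<Delta>(u v) = \<Delta>u * v + u * \<Delta>v + \<Delta>u * \<Delta>v\<close>, so it is enough that it raises the weights of the generators.
\<close>

lemma filt_fdiff:
  assumes "filt G k u" and gens: "\<And>k u. (k, u) \<in> G \<Longrightarrow> filt G (Suc k) (fdiff u)"
  shows "filt G (Suc k) (fdiff u)"
  using assms(1)
proof (induction rule: filt.induct)
  case (gen k u)
  then show ?case by (rule gens)
next
  case (const m)
  show ?case using filt_zero by (simp add: fdiff_def[abs_def])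
next
  case seven
  show ?case using filt_zero by (simp add: fdiff_def[abs_def])
next
  case (add k u v)
  have "fdiff (\<lambda>n. u n + v n) = (\<lambda>n. fdiff u n + fdiff v n)"
    by (auto simp: fdiff_def)
  then show ?case
    using filt.add[OF add.IH] by simp
next
  case (mult j u k v)
  have eq: "fdiff (\<lambda>n. u n * v n) =
      (\<lambda>n. (fdiff u n * v n + u n * fdiff v n) + fdiff u n * fdiff v n)"
    by (auto simp: fdiff_def algebra_simps)
  show ?case
    unfolding eq
    using filt.mult[OF mult.IH(1) mult.hyps(2)] filt.mult[OF mult.hyps(1) mult.IH(2)]
      filt.weaken[OF filt.mult[OF mult.IH], of "Suc (j + k)"]
    by (intro filt.add) simp_all
next
  case (weaken j u k)
  show ?case using weaken.IH by (rule filt.weaken) (use weaken.hyps in simp)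
qed

lemma filt_funpow_fdiff:
  assumes "filt G k u" and "\<And>k u. (k, u) \<in> G \<Longrightarrow> filt G (Suc k) (fdiff u)"
  shows "filt G (k + j) ((fdiff ^^ j) u)"
  using assms(1) by (induction j) (auto intro: filt_fdiff assms(2))

section \<open>The involution attached to a pair of conjugate lines\<close>

text \<open>
  Regard the quartic form as a polynomial in \<open>\<xi>\<close>, \<open>\<eta>\<close> and their conjugates. Since it vanishes on the two
  lines, its value at \<open>(s \<xi>, s \<eta>)\<close> is \<open>N(s) * (A * s^2 + B * N(s) + A' * s'^2)\<close>, where primes denote conjugates,
  \<open>N(s) = s * s'\<close>, \<open>A\<close> is the part of degree 3 in \<open>(\<xi>, \<eta>)\<close>, and \<open>A + B + A'\<close> is the quartic form. The forms
  \<open>S0\<close> and \<open>S1\<close> are the coordinates of \<open>11 * A'\<close> in the basis \<open>1, w\<close>; the factor 11 clears denominators.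
\<close>

definition S0 :: "int \<Rightarrow> int \<Rightarrow> int \<Rightarrow> int \<Rightarrow> int" where
  "S0 a b c d =
      -12*a^4 - 84*a^3*b + 4*a^3*c - 42*a^3*d - 108*a^2*b^2 + 18*a^2*b*c - 90*a^2*b*d
      + 63*a^2*c^2 + 63*a^2*c*d + 297*a^2*d^2 - 216*a*b^3 - 18*a*b^2*c - 108*a*b^2*d
      + 18*a*b*c^2 + 18*a*b*c*d + 162*a*b*d^2 + 6*a*c^3 - 24*a*c^2*d - 12*a*c*d^2 - 90*a*d^3
      + 108*b^3*c + 54*b^3*d - 288*b^2*c^2 - 288*b^2*c*d - 540*b^2*d^2 + 36*b*c^3 + 54*b*c^2*d
      + 126*b*c*d^2 + 54*b*d^3 + 12*c^4 + 36*c^3*d + 36*c^2*d^2 + 48*c*d^3 - 72*d^4"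

definition S1 :: "int \<Rightarrow> int \<Rightarrow> int \<Rightarrow> int \<Rightarrow> int" where
  "S1 a b c d =
      -12*a^4 - 12*a^3*b + 10*a^3*c - 6*a^3*d + 6*a^2*b*c + 36*a^2*b*d + 3*a^2*c^2
      - 33*a^2*c*d + 9*a^2*d^2 + 36*a*b^3 + 48*a*b^2*c + 90*a*b^2*d - 156*a*b*c^2
      - 192*a*b*c*d - 468*a*b*d^2 + 12*a*c^3 + 18*a*c^2*d + 42*a*c*d^2 + 18*a*d^3 + 108*b^4
      + 54*b^3*c + 126*b^3*d - 105*b^2*c^2 - 213*b^2*c*d - 315*b^2*d^2 + 6*b*c^3 + 42*b*c^2*d
      + 54*b*c*d^2 + 108*b*d^3 + 24*c^3*d + 36*c^2*d^2 + 84*c*d^3 + 36*d^4"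

text \<open>
  The expansion in \<open>s\<close> described above, multiplied by 11, for the scalar \<open>s + t * w\<close>. The brackets are the
  traces of \<open>11 * A * (s + t * w)^2\<close> and of \<open>11 * A\<close>, written out in coordinates.
\<close>

lemma quartic_form_twist:
  "11 * quartic_form ((s - t)*a - 3*t*b) (t*a + s*b) (s*c + 3*t*d) ((s - t)*d - t*c) =
    (s^2 - s*t + 3*t^2) *
      ((s^2 - 3*t^2) * (2 * S0 a b c d - S1 a b c d) +
       (2*s*t - t^2) * (6 * S1 a b c d - S0 a b c d) +
       (11 * quartic_form a b c d - (2 * S0 a b c d - S1 a b c d)) * (s^2 - s*t + 3*t^2))"
  unfolding quartic_form_def S0_def S1_def by algebra

text \<open>
  For the scalar \<open>A'\<close> the last factor becomes \<open>A * A'^2 + B * A * A' + A' * A^2 = N(A) * (A + B + A')\<close>, a multiple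
  of the form itself: up to a rational factor, \<open>A'\<close> leads to the fourth intersection point.
\<close>

lemma quartic_form_involution:
  assumes "s = S0 a b c d" "t = S1 a b c d"
  shows "quartic_form ((s - t)*a - 3*t*b) (t*a + s*b) (s*c + 3*t*d) ((s - t)*d - t*c) =
    (s^2 - s*t + 3*t^2)^2 * quartic_form a b c d"
proof -
  have "(s^2 - 3*t^2) * (2*s - t) + (2*s*t - t^2) * (6*t - s) = (2*s - t) * (s^2 - s*t + 3*t^2)"
    by algebra
  then have "11 * quartic_form ((s - t)*a - 3*t*b) (t*a + s*b) (s*c + 3*t*d) ((s - t)*d - t*c) =
      (s^2 - s*t + 3*t^2) * (11 * quartic_form a b c d * (s^2 - s*t + 3*t^2))"
    unfolding quartic_form_twist assms[symmetric] by (simp only: left_diff_distrib) simp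
  then show ?thesis
    by (simp add: power2_eq_square)
qed

lemma quartic_form_scale:
  "quartic_form (- (q * a)) (q * b) (q * c) (q * d) = q ^ 4 * quartic_form a b c d"
  unfolding quartic_form_def by algebra

text \<open>
  A cubic factor that changes the representative of the image point, but not the point. The quintic
  automorphism scales the radial direction at \<open>(0, 1, 1, 0)\<close> by 5 times its value there, which is 1 modulo
  7; in degree 8 the factor is \<open>8 = 1\<close> modulo 7, so that the lifted map to four-space is unipotent too.
  The cubic is chosen so that, to first order, the second coordinate of the image is congruent to \<open>b\<close>
  modulo 7.
\<close>

definition radial :: "int \<Rightarrow> int \<Rightarrow> int \<Rightarrow> int" where
  "radial b c d = b^2 * (4*c - 3*b + 4*d)"

definition step :: "int \<times> int \<times> int \<times> int \<Rightarrow> int \<times> int \<times> int \<times> int" where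
  "step = (\<lambda>(a, b, c, d).
     let s = S0 a b c d; t = S1 a b c d; q = radial b c d
     in (- (q * ((s - t)*a - 3*t*b)), q * (t*a + s*b), q * (s*c + 3*t*d), q * ((s - t)*d - t*c)))"

lemma quartic_form_step:
  assumes "quartic_form a b c d = 0" "step (a, b, c, d) = (a', b', c', d')"
  shows "quartic_form a' b' c' d' = 0"
  using assms by (auto simp: step_def Let_def quartic_form_scale quartic_form_involution)

section \<open>The orbit\<close>

definition orbit :: "nat \<Rightarrow> int \<times> int \<times> int \<times> int" where
  "orbit n = (step ^^ n) (0, 1, 1, 0)"

definition oa :: "nat \<Rightarrow> int" where "oa n = fst (orbit n)"
definition ob :: "nat \<Rightarrow> int" where "ob n = fst (snd (orbit n))"
definition oc :: "nat \<Rightarrow> int" where "oc n = fst (snd (snd (orbit n)))"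
definition od :: "nat \<Rightarrow> int" where "od n = snd (snd (snd (orbit n)))"

definition os :: "nat \<Rightarrow> int" where "os n = S0 (oa n) (ob n) (oc n) (od n)"
definition ot :: "nat \<Rightarrow> int" where "ot n = S1 (oa n) (ob n) (oc n) (od n)"
definition oq :: "nat \<Rightarrow> int" where "oq n = radial (ob n) (oc n) (od n)"

lemma orbit_eq: "orbit n = (oa n, ob n, oc n, od n)"
  by (simp add: oa_def ob_def oc_def od_def)

lemma orbit_0: "oa 0 = 0" "ob 0 = 1" "oc 0 = 1" "od 0 = 0"
  by (simp_all add: oa_def ob_def oc_def od_def orbit_def)

lemma orbit_Suc:
  "oa (Suc n) = - (oq n * ((os n - ot n) * oa n - 3 * ot n * ob n))"
  "ob (Suc n) = oq n * (ot n * oa n + os n * ob n)"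
  "oc (Suc n) = oq n * (os n * oc n + 3 * ot n * od n)"
  "od (Suc n) = oq n * ((os n - ot n) * od n - ot n * oc n)"
proof -
  have "orbit (Suc n) = step (oa n, ob n, oc n, od n)"
    by (simp add: orbit_def flip: orbit_eq)
  then have "(oa (Suc n), ob (Suc n), oc (Suc n), od (Suc n)) = step (oa n, ob n, oc n, od n)"
    by (simp only: orbit_eq)
  then show
    "oa (Suc n) = - (oq n * ((os n - ot n) * oa n - 3 * ot n * ob n))"
    "ob (Suc n) = oq n * (ot n * oa n + os n * ob n)"
    "oc (Suc n) = oq n * (os n * oc n + 3 * ot n * od n)"
    "od (Suc n) = oq n * ((os n - ot n) * od n - ot n * oc n)"
    by (simp_all add: step_def Let_def os_def ot_def oq_def)
qed

lemma orbit_on_quartic: "quartic_form (oa n) (ob n) (oc n) (od n) = 0"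
proof (induction n)
  case 0
  show ?case by (simp add: orbit_0 quartic_form_def)
next
  case (Suc n)
  have "step (oa n, ob n, oc n, od n) = (oa (Suc n), ob (Suc n), oc (Suc n), od (Suc n))"
    by (simp add: orbit_def flip: orbit_eq)
  then show ?case
    using quartic_form_step Suc.IH by blast
qed

lemma orbit_cong:
  "[oa n = 0] (mod 7) \<and> [ob n = 1] (mod 7) \<and> [oc n = 1] (mod 7) \<and> [od n = 0] (mod 7)"
proof (induction n)
  case 0
  show ?case by (simp add: orbit_0)
next
  case (Suc n)
  then have a: "[oa n = 0] (mod 7)" and b: "[ob n = 1] (mod 7)"
    and c: "[oc n = 1] (mod 7)" and d: "[od n = 0] (mod 7)"
    by auto
  have s: "[os n = S0 0 1 1 0] (mod 7)"
    unfolding os_def S0_def by (intro cong_add cong_diff cong_mult cong_pow cong_refl a b c d)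
  have t: "[ot n = S1 0 1 1 0] (mod 7)"
    unfolding ot_def S1_def by (intro cong_add cong_diff cong_mult cong_pow cong_refl a b c d)
  have q: "[oq n = radial 1 1 0] (mod 7)"
    unfolding oq_def radial_def by (intro cong_add cong_diff cong_mult cong_pow cong_refl b c d)
  have "S0 0 1 1 0 = -132" "S1 0 1 1 0 = 63" "radial 1 1 0 = 1"
    by (simp_all add: S0_def S1_def radial_def)
  note vals = s[unfolded this] t[unfolded this] q[unfolded this]
  note I = cong_add cong_diff cong_mult cong_refl cong_minus_minus_iff[THEN iffD2] a b c d vals
  have "[oa (Suc n) = - (1 * ((-132 - 63) * 0 - 3 * 63 * 1))] (mod 7)"
    unfolding orbit_Suc by (rule I)+
  moreover have "[ob (Suc n) = 1 * (63 * 0 + (-132) * 1)] (mod 7)"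
    unfolding orbit_Suc by (rule I)+
  moreover have "[oc (Suc n) = 1 * ((-132) * 1 + 3 * 63 * 0)] (mod 7)"
    unfolding orbit_Suc by (rule I)+
  moreover have "[od (Suc n) = 1 * ((-132 - 63) * 0 - 63 * 1)] (mod 7)"
    unfolding orbit_Suc by (rule I)+
  ultimately show ?case
    by (simp add: cong_def)
qed

text \<open>
  The weights reflect the linear part of the map modulo 7: \<open>a\<close> changes by a multiple of \<open>c - b\<close>, and \<open>d\<close> by a
  combination of \<open>a\<close> and \<open>c - b\<close>, so that \<open>d\<close> has to weigh less than \<open>a\<close>, and \<open>a\<close> less than \<open>c - b\<close>. Weights of
  at least 3 force all quadratic terms into weight 6, the most that a difference of a generator has to
  reach.
\<close>

definition gens :: "(nat \<times> (nat \<Rightarrow> int)) set" where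
  "gens = {(4, oa), (4, \<lambda>n. ob n - 1), (5, \<lambda>n. oc n - ob n), (3, od)}"

lemma filt_gens:
  "filt gens 4 oa" "filt gens 4 (\<lambda>n. ob n - 1)" "filt gens 5 (\<lambda>n. oc n - ob n)" "filt gens 3 od"
  by (simp_all add: filt.gen gens_def)

lemma filt_gens_3:
  "filt gens 3 oa" "filt gens 3 (\<lambda>n. ob n - 1)" "filt gens 3 (\<lambda>n. oc n - ob n)"
  by (rule filt.weaken, rule filt_gens, simp)+

lemma gens_dvd:
  assumes "(k, u) \<in> gens"
  shows "7 ^ ((k + 4) div 5) dvd u n"
proof -
  have "[oc n = ob n] (mod 7)"
    using orbit_cong[of n] by (metis cong_sym cong_trans)
  then show ?thesis
    using assms orbit_cong[of n] by (auto simp: gens_def cong_iff_dvd_diff)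
qed

lemma filt_gens_dvd: "filt gens k u \<Longrightarrow> 7 ^ ((k + 4) div 5) dvd u n"
  by (erule filt_dvd) (rule gens_dvd)

section \<open>First-order jets of the step map\<close>

text \<open>
  First-order Taylor expansion at \<open>(0, 1, 1, 0)\<close> in the coordinates \<open>a\<close>, \<open>b - 1\<close>, \<open>c - b\<close>, \<open>d\<close>, with the quadratic
  terms absorbed by weight 6. The direction of \<open>b - 1\<close> is the radial one.
\<close>

definition jet :: "(nat \<Rightarrow> int) \<Rightarrow> int \<Rightarrow> int \<Rightarrow> int \<Rightarrow> int \<Rightarrow> int \<Rightarrow> bool" where
  "jet u t0 ta tb tc td \<longleftrightarrow> filt gens 6
     (\<lambda>n. u n - (t0 + (ta * oa n + tb * (ob n - 1) + tc * (oc n - ob n) + td * od n)))"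

lemma filt_linear: "filt gens 3 (\<lambda>n. ta * oa n + tb * (ob n - 1) + tc * (oc n - ob n) + td * od n)"
  by (intro filt.add filt_smult filt_gens filt_gens_3)

lemma jet_const: "jet (\<lambda>_. m) m 0 0 0 0"
  by (simp add: jet_def filt_zero)

lemma jet_coords:
  "jet oa 0 1 0 0 0" "jet ob 1 0 1 0 0" "jet oc 1 0 1 1 0" "jet od 0 0 0 0 1"
  by (simp_all add: jet_def filt_zero)

lemma jet_add:
  assumes "jet u t0 ta tb tc td" "jet v s0 sa sb sc sd"
  shows "jet (\<lambda>n. u n + v n) (t0 + s0) (ta + sa) (tb + sb) (tc + sc) (td + sd)"
  using filt.add[OF assms[unfolded jet_def]] unfolding jet_def by (simp add: algebra_simps)

lemma jet_minus:
  assumes "jet u t0 ta tb tc td"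
  shows "jet (\<lambda>n. - u n) (- t0) (- ta) (- tb) (- tc) (- td)"
  using filt_smult[OF assms[unfolded jet_def], of "-1"] unfolding jet_def
  by (simp add: algebra_simps)

lemma jet_diff:
  assumes "jet u t0 ta tb tc td" "jet v s0 sa sb sc sd"
  shows "jet (\<lambda>n. u n - v n) (t0 - s0) (ta - sa) (tb - sb) (tc - sc) (td - sd)"
  using jet_add[OF assms(1) jet_minus[OF assms(2)]] by simp

lemma jet_mult:
  assumes "jet u t0 ta tb tc td" "jet v s0 sa sb sc sd"
  shows "jet (\<lambda>n. u n * v n) (t0 * s0) (t0 * sa + ta * s0) (t0 * sb + tb * s0)
           (t0 * sc + tc * s0) (t0 * sd + td * s0)"
proof -
  define lu where "lu n = ta * oa n + tb * (ob n - 1) + tc * (oc n - ob n) + td * od n" for n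
  define lv where "lv n = sa * oa n + sb * (ob n - 1) + sc * (oc n - ob n) + sd * od n" for n
  define ru where "ru n = u n - (t0 + lu n)" for n
  define rv where "rv n = v n - (s0 + lv n)" for n
  have l: "filt gens 3 lu" "filt gens 3 lv"
    unfolding lu_def lv_def by (rule filt_linear)+
  have r: "filt gens 6 ru" "filt gens 6 rv"
    using assms unfolding jet_def ru_def[abs_def] lu_def rv_def[abs_def] lv_def .
  have l0: "filt gens 0 (\<lambda>n. t0 + lu n)" "filt gens 0 (\<lambda>n. s0 + lv n)"
    by (intro filt.add filt.const filt.weaken[OF l(1)] filt.weaken[OF l(2)], simp)+
  have "filt gens 6 (\<lambda>n. lu n * lv n)"
    using filt.mult[OF l] by simp
  moreover have "filt gens 6 (\<lambda>n. ru n * (s0 + lv n))"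
    using filt.mult[OF r(1) l0(2)] by simp
  moreover have "filt gens 6 (\<lambda>n. (t0 + lu n) * rv n)"
    using filt.mult[OF l0(1) r(2)] by simp
  moreover have "filt gens 6 (\<lambda>n. ru n * rv n)"
    using filt.weaken[OF filt.mult[OF r], of 6] by simp
  ultimately have
    "filt gens 6 (\<lambda>n. lu n * lv n + ru n * (s0 + lv n) + (t0 + lu n) * rv n + ru n * rv n)"
    by (intro filt.add)
  moreover have "lu n * lv n + ru n * (s0 + lv n) + (t0 + lu n) * rv n + ru n * rv n =
      u n * v n - (t0 * s0 + ((t0 * sa + ta * s0) * oa n + (t0 * sb + tb * s0) * (ob n - 1) +
        (t0 * sc + tc * s0) * (oc n - ob n) + (t0 * sd + td * s0) * od n))" for n
    unfolding ru_def rv_def lu_def lv_def by (simp add: algebra_simps)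
  ultimately show ?thesis
    unfolding jet_def by simp
qed

lemma jet_power:
  assumes "jet u t0 ta tb tc td"
  shows "jet (\<lambda>n. u n ^ k) (t0 ^ k) (of_nat k * t0 ^ (k - 1) * ta) (of_nat k * t0 ^ (k - 1) * tb)
           (of_nat k * t0 ^ (k - 1) * tc) (of_nat k * t0 ^ (k - 1) * td)"
proof (induction k)
  case 0
  show ?case using jet_const[of 1] by simp
next
  case (Suc k)
  note IH = Suc.IH
  show ?case
  proof (cases k)
    case 0
    then show ?thesis using assms by simp
  next
    case (Suc m)
    then show ?thesis using jet_mult[OF assms IH] by (simp add: algebra_simps)
  qed
qed

lemma jet_cong:
  assumes "jet u t0 ta tb tc td" "t0 = s0" "ta = sa" "tb = sb" "tc = sc" "td = sd"
  shows "jet u s0 sa sb sc sd"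
  using assms by simp

lemmas jet_intros = jet_coords jet_const jet_add jet_minus jet_diff jet_mult jet_power

lemma jet_os: "jet os (-132) (-210) (-528) (-312) (-144)"
  unfolding os_def S0_def by (rule jet_cong, (rule jet_intros)+, simp_all)

lemma jet_ot: "jet ot 63 (-60) 252 (-138) (-21)"
  unfolding ot_def S1_def by (rule jet_cong, (rule jet_intros)+, simp_all)

lemma jet_oq: "jet oq 1 0 3 4 4"
  unfolding oq_def radial_def by (rule jet_cong, (rule jet_intros)+, simp_all)

lemma jet_orbit_Suc:
  "jet (\<lambda>n. oa (Suc n)) 189 15 1512 342 693"
  "jet (\<lambda>n. ob (Suc n)) (-132) (-147) (-1056) (-840) (-672)"
  "jet (\<lambda>n. oc (Suc n)) (-132) (-210) (-1056) (-972) (-483)"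
  "jet (\<lambda>n. od (Suc n)) (-63) 60 (-504) (-177) (-426)"
  unfolding orbit_Suc by (rule jet_cong, (rule jet_intros jet_os jet_ot jet_oq)+, simp_all)+

lemma jet_fdiff:
  "jet (fdiff oa) 189 14 1512 342 693"
  "jet (fdiff ob) (-133) (-147) (-1057) (-840) (-672)"
  "jet (fdiff (\<lambda>n. oc n - ob n)) 0 (-63) 0 (-133) 189"
  "jet (fdiff od) (-63) 60 (-504) (-177) (-427)"
  unfolding fdiff_def[abs_def]
  by (rule jet_cong, (rule jet_intros jet_orbit_Suc)+, simp_all)+

lemma filt_of_jet:
  assumes "jet u t0 ta tb tc td" "k \<le> 6"
    and "filt gens k (\<lambda>n. t0 + (ta * oa n + tb * (ob n - 1) + tc * (oc n - ob n) + td * od n))"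
  shows "filt gens k u"
  using filt.add[OF filt.weaken[OF assms(1)[unfolded jet_def] assms(2)] assms(3)] by simp

lemma filt_term_seven:
  assumes "7 dvd m"
  shows "filt gens 6 (\<lambda>n. m * oa n)" "filt gens 6 (\<lambda>n. m * (ob n - 1))"
    "filt gens 6 (\<lambda>n. m * (oc n - ob n))" "filt gens 6 (\<lambda>n. m * od n)"
  by (rule filt.weaken, rule filt_smult_seven[OF assms], rule filt_gens, simp)+

text \<open>
  In the four lemmas that follow, the coefficients of \<open>jet_fdiff\<close> that are divisible by 7 contribute five
  extra units of weight; the remaining ones fall on generators that are heavy enough.
\<close>

lemma filt_fdiff_oa: "filt gens 5 (fdiff oa)"
proof (rule filt_of_jet[OF jet_fdiff(1)])
  show "filt gens 5 (\<lambda>n. 189 + (14 * oa n + 1512 * (ob n - 1) + 342 * (oc n - ob n) + 693 * od n))"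
    by (intro filt.add filt_const_seven filt_smult filt_gens filt_term_seven[THEN filt.weaken])
      simp_all
qed simp

lemma filt_fdiff_ob: "filt gens 5 (fdiff ob)"
proof (rule filt_of_jet[OF jet_fdiff(2)])
  show "filt gens 5 (\<lambda>n. -133 + (-147 * oa n + -1057 * (ob n - 1) + -840 * (oc n - ob n) + -672 * od n))"
    by (intro filt.add filt_const_seven filt_term_seven[THEN filt.weaken]) simp_all
qed simp

lemma filt_fdiff_oc: "filt gens 6 (fdiff (\<lambda>n. oc n - ob n))"
proof (rule filt_of_jet[OF jet_fdiff(3)])
  show "filt gens 6 (\<lambda>n. 0 + (-63 * oa n + 0 * (ob n - 1) + -133 * (oc n - ob n) + 189 * od n))"
    by (intro filt.add filt_zero filt_term_seven) simp_all
qed simp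

lemma filt_fdiff_od: "filt gens 4 (fdiff od)"
proof (rule filt_of_jet[OF jet_fdiff(4)])
  have gamma: "filt gens 4 (\<lambda>n. -177 * (oc n - ob n))"
    by (rule filt.weaken[OF filt_smult[OF filt_gens(3)]]) simp
  have const: "filt gens 4 (\<lambda>_. -63)"
    by (rule filt.weaken[OF filt_const_seven]) simp_all
  have rest: "filt gens 4 (\<lambda>n. -504 * (ob n - 1))" "filt gens 4 (\<lambda>n. -427 * od n)"
    by (rule filt.weaken[OF filt_term_seven(2)] filt.weaken[OF filt_term_seven(4)]; simp)+
  show "filt gens 4 (\<lambda>n. -63 + (60 * oa n + -504 * (ob n - 1) + -177 * (oc n - ob n) + -427 * od n))"
    by (rule filt.add const filt_smult[OF filt_gens(1)] rest gamma)+
qed simp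

lemma filt_fdiff_gens: "(k, u) \<in> gens \<Longrightarrow> filt gens (Suc k) (fdiff u)"
proof -
  assume "(k, u) \<in> gens"
  moreover have "fdiff (\<lambda>n. ob n - 1) = fdiff ob"
    by (simp add: fdiff_def[abs_def])
  ultimately show ?thesis
    using filt_fdiff_oa filt_fdiff_ob filt_fdiff_oc filt_fdiff_od by (auto simp: gens_def)
qed

section \<open>Points of the orbit are pairwise non-proportional\<close>

text \<open>
  The weight of \<open>c - b\<close> alone gives divisibility by 7. The second factor 7, which is needed to evaluate
  \<open>fdiff oa\<close> modulo 49, comes from the start \<open>b = c = 1\<close>, because the differences have weight 6.
\<close>

lemma oc_minus_ob_dvd: "49 dvd oc n - ob n"
proof (induction n)
  case 0
  show ?case by (simp add: orbit_0)
next
  case (Suc n)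
  have "49 dvd fdiff (\<lambda>n. oc n - ob n) n"
    using filt_gens_dvd[OF filt_fdiff_oc, of n] by simp
  then show ?case
    using Suc.IH by (metis dvd_add fdiff_def diff_add_cancel)
qed

lemma fdiff_oa_mod: "49 dvd fdiff oa n - 189"
proof -
  have "7 * 7 dvd fdiff oa n - (189 + (14 * oa n + 1512 * (ob n - 1) + 342 * (oc n - ob n) + 693 * od n))"
    using filt_gens_dvd[OF jet_fdiff(1)[unfolded jet_def], of n] by simp
  moreover have d: "7 dvd oa n" "7 dvd ob n - 1" "7 dvd od n"
    using orbit_cong[of n] by (simp_all add: cong_iff_dvd_diff)
  have "7 * 7 dvd 14 * oa n" "7 * 7 dvd 1512 * (ob n - 1)" "7 * 7 dvd 693 * od n"
    by (rule mult_dvd_mono[OF _ d(1)] mult_dvd_mono[OF _ d(2)] mult_dvd_mono[OF _ d(3)]; simp)+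
  moreover have "7 * 7 dvd 342 * (oc n - ob n)"
    using dvd_mult[OF oc_minus_ob_dvd, of 342 n] by simp
  ultimately have "7 * 7 dvd (fdiff oa n -
      (189 + (14 * oa n + 1512 * (ob n - 1) + 342 * (oc n - ob n) + 693 * od n))) +
      (14 * oa n + 1512 * (ob n - 1) + 342 * (oc n - ob n) + 693 * od n)"
    by (intro dvd_add)
  then show ?thesis
    by (simp add: algebra_simps)
qed

text \<open>
  For fixed \<open>m\<close> the cross product vanishes at \<open>n = 0\<close>, and its first difference there is
  \<open>189 = -7\<close> modulo 49, to which the non-vanishing criterion applies.
\<close>

lemma orbit_cross_nonzero:
  assumes "0 < n"
  shows "oa (m + n) * ob m - oa m * ob (m + n) \<noteq> 0"
proof -
  define u where "u k = oa k * ob m - oa m * ob k" for k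
  have diff_u: "fdiff u = (\<lambda>k. ob m * fdiff oa k + (- oa m) * fdiff ob k)"
    by (auto simp: fdiff_def u_def algebra_simps)
  have filt_u: "filt gens 5 (fdiff u)"
    unfolding diff_u by (intro filt.add filt_smult filt_fdiff_oa filt_fdiff_ob)
  have "\<not> 49 dvd fdiff u m"
  proof -
    obtain x where x: "fdiff oa m = 189 + 49 * x"
      using fdiff_oa_mod[of m] by (metis add.commute diff_add_cancel dvdE)
    obtain y where y: "ob m = 1 + 7 * y"
      using orbit_cong[of m] by (metis add.commute cong_iff_dvd_diff diff_add_cancel dvdE)
    obtain z where z: "oa m = 7 * z"
      using orbit_cong[of m] by (auto simp: cong_iff_dvd_diff)
    have "7 dvd fdiff ob m"
      using filt_gens_dvd[OF filt_fdiff_ob, of m] by simp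
    then obtain w where w: "fdiff ob m = 7 * w" ..
    define r where "r = x + 27 * y + 7 * x * y - z * w"
    have "fdiff u m = 189 + 49 * r"
      unfolding diff_u x y z w r_def by (simp add: algebra_simps)
    then show ?thesis
      by presburger
  qed
  moreover have "7 ^ ((j + 8) div 5) dvd (fdiff ^^ j) u m" if "2 \<le> j" for j
  proof -
    have "(fdiff ^^ j) u = (fdiff ^^ (j - 1)) (fdiff u)"
      using that by (cases j) (simp_all add: funpow_swap1)
    then have "filt gens (5 + (j - 1)) ((fdiff ^^ j) u)"
      using filt_funpow_fdiff[OF filt_u filt_fdiff_gens] by simp
    then show ?thesis
      using filt_gens_dvd[of "5 + (j - 1)" "(fdiff ^^ j) u" m] that by (simp add: add.commute)
  qed
  moreover have "u m = 0"
    by (simp add: u_def)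
  ultimately have "u (m + n) \<noteq> 0"
    using nonzero_of_differences[of "\<lambda>n. u (m + n)" n] assms
      funpow_fdiff_shift[of _ u m 0] funpow_fdiff_shift[of 1 u m 0] by simp
  then show ?thesis
    by (simp add: u_def)
qed

lemma orbit_in_solutions: "orbit n \<in> quartic_solutions"
proof -
  have "ob n \<noteq> 0" "oc n \<noteq> 0"
    using orbit_cong[of n] by (auto simp: cong_def)
  then show ?thesis
    by (simp add: orbit_eq quartic_solutions_def orbit_on_quartic)
qed

lemma orbit_not_proportional:
  assumes "m < n"
  shows "\<not> proportional (orbit m) (orbit n)"
proof
  assume "proportional (orbit m) (orbit n)"
  then obtain q :: rat where "of_int (oa n) = q * of_int (oa m)" "of_int (ob n) = q * of_int (ob m)"
    by (auto simp: orbit_eq proportional_def)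
  then have "(of_int (oa n * ob m) :: rat) = of_int (oa m * ob n)"
    by simp
  then have "oa n * ob m = oa m * ob n"
    by (simp only: of_int_eq_iff)
  then show False
    using orbit_cross_nonzero[of "n - m" m] assms by simp
qed

theorem mainTheorem4:
  shows "infinite (quartic_solutions // proportional_rel)"
proof -
  let ?cls = "\<lambda>n. proportional_rel `` {orbit n}"
  have "inj ?cls"
  proof (rule linorder_injI)
    fix m n :: nat
    assume "m < n"
    then have "(orbit m, orbit n) \<notin> proportional_rel"
      using orbit_not_proportional by (auto simp: proportional_rel_def)
    then show "?cls m \<noteq> ?cls n"
      using eq_equiv_class[OF _ equiv_proportional_rel orbit_in_solutions] by blast
  qed
  then have "infinite (range ?cls)"
    using finite_imageD by blast
  moreover have "range ?cls \<subseteq> quartic_solutions // proportional_rel"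
    using orbit_in_solutions by (auto intro: quotientI)
  ultimately show ?thesis
    using finite_subset by blast
qed

end
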